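(* $\overline\tau(K_n) = O(\sqrt{n\log n})$; that is, there is a constant $C$ such that for all $n\ge 2$ there exist a straight-line drawing of $K_n$ and an edge-ordering of it in which every non-crossing monotone complete binary tree has at most $C\sqrt{n\log n}$ vertices.
   Context: A geometric graph is a graph whose vertices are points in the plane in general position and whose edges are straight line segments; a straight-line drawing of $G$ is a geometric graph isomorphic to $G$. An edge-ordering is a total order on the edges. In an edge-ordered graph, a path $v_1v_2\ldots v_k$ is increasing if $(v_iv_{i+1}) > (v_{i+1}v_{i+2})$ for all $i=1,\ldots,k-2$ and decreasing if $(v_iv_{i+1}) < (v_{i+1}v_{i+2})$ for all $i$. All binary trees are complete and rooted (every internal vertex has exactly two children and all leaves are at the same depth); the size of a tree is its number of vertices. A rooted tree is increasing (resp. decreasing) if every path from the root to a leaf is increasing (resp. decreasing), and monotone if it is increasing or decreasing. A tree in a geometric graph is non-crossing if no two of its edges cross. $\overline\tau(\widetilde G)$ is the minimum over all edge-orderings of $\widetilde G$ of the maximum size of a non-crossing monotone binary tree in $\widetilde G$, and $\overline\tau(G)$ is the minimum of $\overline\tau(\widetilde G)$ over all straight-line drawings $\widetilde G$ of $G$. *)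

theory Defs
  imports "HOL-Analysis.Analysis" "HOL-Library.Tree" "HOL-Library.Ramsey"
    "HOL-Library.Landau_Symbols"
begin

type_synonym 'a ugraph = "'a set \<times> 'a set set"

abbreviation verts :: "'a ugraph \<Rightarrow> 'a set" where "verts G \<equiv> fst G"
abbreviation edges :: "'a ugraph \<Rightarrow> 'a set set" where "edges G \<equiv> snd G"

definition simple_graph :: "'a ugraph \<Rightarrow> bool" where
  "simple_graph G \<longleftrightarrow> finite (verts G) \<and> edges G \<subseteq> [verts G]\<^bsup>2\<^esup>"

definition complete_ugraph :: "nat \<Rightarrow> nat ugraph" where
  "complete_ugraph n = ({..<n}, [{..<n}]\<^bsup>2\<^esup>)"

definition isomorphic :: "'a ugraph \<Rightarrow> 'b ugraph \<Rightarrow> bool" where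
  "isomorphic G H \<longleftrightarrow>
     (\<exists>f. bij_betw f (verts G) (verts H) \<and> edges H = (\<lambda>e. f ` e) ` edges G)"

type_synonym point = "real \<times> real"

definition general_position :: "point set \<Rightarrow> bool" where
  "general_position P \<longleftrightarrow>
     (\<forall>a\<in>P. \<forall>b\<in>P. \<forall>c\<in>P. a \<noteq> b \<and> b \<noteq> c \<and> a \<noteq> c \<longrightarrow> \<not> collinear {a, b, c})"

text \<open>An edge \<open>{a, b}\<close> of a geometric graph stands for the segment from \<open>a\<close> to \<open>b\<close>.\<close>

definition geometric_graph :: "point ugraph \<Rightarrow> bool" where
  "geometric_graph H \<longleftrightarrow> simple_graph H \<and> general_position (verts H)"

definition drawings :: "'a ugraph \<Rightarrow> point ugraph set" where
  "drawings G = {H. geometric_graph H \<and> isomorphic G H}"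

text \<open>Open segments are used so that edges meeting in a common endpoint do not cross. In general
  position an endpoint of one edge never lies in the interior of another edge.\<close>

definition crosses :: "point set \<Rightarrow> point set \<Rightarrow> bool" where
  "crosses e f \<longleftrightarrow> e \<noteq> f \<and>
     (\<exists>a b c d. e = {a, b} \<and> f = {c, d} \<and> open_segment a b \<inter> open_segment c d \<noteq> {})"

text \<open>An edge-ordering of \<open>H\<close> is a reflexive linear order \<open>r\<close> on \<open>edges H\<close>; its strict part is\<close>

definition less_in :: "'b rel \<Rightarrow> 'b \<Rightarrow> 'b \<Rightarrow> bool" where
  "less_in r e f \<longleftrightarrow> (e, f) \<in> r \<and> e \<noteq> f"

definition edge_orderings :: "'a ugraph \<Rightarrow> 'a set rel set" where
  "edge_orderings G = {r. linear_order_on (edges G) r}"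

text \<open>By convention, edges get \<^emph>\<open>smaller\<close> along an increasing path.\<close>

definition increasing_path :: "'a set rel \<Rightarrow> 'a list \<Rightarrow> bool" where
  "increasing_path r p \<longleftrightarrow>
     (\<forall>i. i + 2 < length p \<longrightarrow> less_in r {p ! (i + 1), p ! (i + 2)} {p ! i, p ! (i + 1)})"

definition decreasing_path :: "'a set rel \<Rightarrow> 'a list \<Rightarrow> bool" where
  "decreasing_path r p \<longleftrightarrow>
     (\<forall>i. i + 2 < length p \<longrightarrow> less_in r {p ! i, p ! (i + 1)} {p ! (i + 1), p ! (i + 2)})"

text \<open>Rooted binary trees in a graph are represented by values of type \<^typ>\<open>'a tree\<close> with
  pairwise distinct labels. The vertices are the \<^const>\<open>Node\<close>s, so \<^const>\<open>size\<close> counts vertices;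
  \<^const>\<open>Leaf\<close> is the empty tree, and a leaf in the graph-theoretic sense is \<open>Node Leaf x Leaf\<close>.
  Under this reading \<^const>\<open>Tree.complete\<close> says that every vertex has no or two children and that
  all leaves have the same depth.\<close>

fun root_set :: "'a tree \<Rightarrow> 'a set" where
  "root_set Leaf = {}"
| "root_set (Node l x r) = {x}"

fun tree_edges :: "'a tree \<Rightarrow> 'a set set" where
  "tree_edges Leaf = {}"
| "tree_edges (Node l x r) =
     (\<lambda>y. {x, y}) ` (root_set l \<union> root_set r) \<union> tree_edges l \<union> tree_edges r"

fun root_leaf_paths :: "'a tree \<Rightarrow> 'a list set" where
  "root_leaf_paths Leaf = {}"
| "root_leaf_paths (Node l x r) =
     (if l = Leaf \<and> r = Leaf then {[x]}
      else (\<lambda>p. x # p) ` (root_leaf_paths l \<union> root_leaf_paths r))"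

definition complete_binary_tree_in :: "'a ugraph \<Rightarrow> 'a tree \<Rightarrow> bool" where
  "complete_binary_tree_in G t \<longleftrightarrow>
     t \<noteq> Leaf \<and> Tree.complete t \<and> distinct (inorder t) \<and>
     set_tree t \<subseteq> verts G \<and> tree_edges t \<subseteq> edges G"

definition monotone_tree :: "'a set rel \<Rightarrow> 'a tree \<Rightarrow> bool" where
  "monotone_tree r t \<longleftrightarrow>
     (\<forall>p\<in>root_leaf_paths t. increasing_path r p) \<or> (\<forall>p\<in>root_leaf_paths t. decreasing_path r p)"

definition noncrossing_tree :: "point tree \<Rightarrow> bool" where
  "noncrossing_tree t \<longleftrightarrow> (\<forall>e\<in>tree_edges t. \<forall>f\<in>tree_edges t. \<not> crosses e f)"

definition noncrossing_monotone_trees :: "point ugraph \<Rightarrow> point set rel \<Rightarrow> point tree set" where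
  "noncrossing_monotone_trees H r =
     {t. complete_binary_tree_in H t \<and> monotone_tree r t \<and> noncrossing_tree t}"

text \<open>The infima below are minima, being taken over nonempty sets of natural numbers.
  The maximum is over a finite set, which is nonempty as soon as \<open>H\<close> has a vertex.\<close>

definition tau_geom :: "point ugraph \<Rightarrow> nat" where
  "tau_geom H = (INF r\<in>edge_orderings H. Max (size ` noncrossing_monotone_trees H r))"

definition tau_bar :: "'a ugraph \<Rightarrow> nat" where
  "tau_bar G = (INF H\<in>drawings G. tau_geom H)"

end

theory Submission imports Defs begin

text \<open>
  Place the vertices on a parabola, so that edges cross exactly when they interleave, and let the
  length of an edge be the distance of the \<open>x\<close>-coordinates. With \<open>a = sqrt (n / ln n)\<close>, put all
  short edges (length at most \<open>a\<close>) below all long edges, and within each class let the longer of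
  two edges be the smaller one.

  At least one child \<open>v\<close> of the root \<open>p\<close> of a non-crossing tree spans a subtree whose hull (of
  \<open>x\<close>-coordinates) does not contain \<open>p\<close>; below it, the hulls of the two subtrees of any vertex are
  disjoint and do not contain that vertex.

  On a root-leaf path of a decreasing tree short edges are followed by long ones. Vertices reached
  by short edges only are within \<open>O(a ln n)\<close> of the root, and every lowest cherry with long edges
  has its own interval of length \<open>a\<close>; so there are \<open>O(a ln n + n / a)\<close> vertices.

  In an increasing tree long edges are followed by short ones, with lengths growing in each class.
  Then a vertex lies at the end of its hull, so the edge to its farther child is at least as long
  as the hull of the nearer subtree, and so are all edges below it. Hence the width is squared at
  each level, and the height is \<open>O(ln (ln n))\<close>.
\<close>

section \<open>Non-crossing trees and hulls\<close>

text \<open>\<open>p\<close> is the parent of the root of the tree.\<close>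

fun descending :: "('a \<Rightarrow> 'a \<Rightarrow> 'a \<Rightarrow> bool) \<Rightarrow> 'a \<Rightarrow> 'a tree \<Rightarrow> bool" where
  "descending R p Leaf = True"
| "descending R p (Node l v r) =
     ((\<forall>w\<in>root_set l \<union> root_set r. R p v w) \<and> descending R v l \<and> descending R v r)"

lemma descending_mono:
  assumes "descending R p t"
    and "\<And>u v w. u \<in> insert p (set_tree t) \<Longrightarrow> v \<in> set_tree t \<Longrightarrow> w \<in> set_tree t \<Longrightarrow> R u v w \<Longrightarrow> R' u v w"
  shows "descending R' p t"
  using assms
proof (induction t arbitrary: p)
  case (Node l v r)
  have "root_set l \<subseteq> set_tree l" "root_set r \<subseteq> set_tree r"
    by (cases l; simp) (cases r; simp)
  moreover have "descending R' v l"
    using Node.prems by (intro Node.IH(1)) auto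
  moreover have "descending R' v r"
    using Node.prems by (intro Node.IH(2)) auto
  ultimately show ?case using Node.prems by auto
qed simp

lemma root_leaf_path_from_root:
  assumes "w \<in> root_set t"
  shows "\<exists>q\<in>root_leaf_paths t. q \<noteq> [] \<and> q ! 0 = w"
proof -
  have ex: "\<exists>q. q \<in> root_leaf_paths t" if "t \<noteq> Leaf" for t :: "'a tree"
    using that by (induction t) auto
  obtain l r where t: "t = Node l w r" using assms by (cases t) auto
  show ?thesis
  proof (cases "l = Leaf \<and> r = Leaf")
    case False
    then obtain q where "q \<in> root_leaf_paths l \<union> root_leaf_paths r"
      using ex[of l] ex[of r] by blast
    then have "w # q \<in> root_leaf_paths t" using False t by auto
    then show ?thesis by (intro bexI[of _ "w # q"]) simp_all
  qed (use t in simp)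
qed

text \<open>Turns a condition on root-leaf paths into one that inductions on the tree can use. With
  \<open>p\<close> prepended, the triple at index 0 concerns the root, and the later triples are
  those of the subtrees, shifted by one.\<close>

lemma descending_if_paths:
  assumes "\<forall>q\<in>root_leaf_paths t. \<forall>i. i + 2 < length (p # q) \<longrightarrow>
      R ((p # q) ! i) ((p # q) ! (i + 1)) ((p # q) ! (i + 2))"
  shows "descending R p t"
  using assms
proof (induction t arbitrary: p)
  case (Node l v r)
  have sub: "descending R v s \<and> (\<forall>w\<in>root_set s. R p v w)"
    if s: "s = l \<or> s = r" "s \<noteq> Leaf" for s
  proof -
    have ext: "v # q \<in> root_leaf_paths (Node l v r)" if "q \<in> root_leaf_paths s" for q
      using s that by auto
    have *: "R ((p # v # q) ! i) ((p # v # q) ! (i + 1)) ((p # v # q) ! (i + 2))"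
      if "q \<in> root_leaf_paths s" "i + 2 < length (p # v # q)" for q i
      using Node.prems[rule_format, OF ext[OF that(1)] that(2)] .
    have H: "\<forall>q\<in>root_leaf_paths s. \<forall>i. i + 2 < length (v # q) \<longrightarrow>
        R ((v # q) ! i) ((v # q) ! (i + 1)) ((v # q) ! (i + 2))"
    proof (intro ballI allI impI)
      fix q i assume "q \<in> root_leaf_paths s" "i + 2 < length (v # q)"
      then show "R ((v # q) ! i) ((v # q) ! (i + 1)) ((v # q) ! (i + 2))"
        using *[of q "Suc i"] by simp
    qed
    from s(1) have "descending R v s"
    proof
      assume "s = l"
      with Node.IH(1)[of v] H show ?thesis by (simp only:)
    next
      assume "s = r"
      with Node.IH(2)[of v] H show ?thesis by (simp only:)
    qed
    moreover have "R p v w" if w: "w \<in> root_set s" for w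
    proof -
      obtain q where "q \<in> root_leaf_paths s" "q \<noteq> []" "q ! 0 = w"
        using root_leaf_path_from_root[OF w] by blast
      then show ?thesis using *[of q 0] by (cases q) simp_all
    qed
    ultimately show ?thesis by blast
  qed
  have "descending R v l \<and> (\<forall>w\<in>root_set l. R p v w)" using sub[of l] by (cases "l = Leaf") auto
  moreover have "descending R v r \<and> (\<forall>w\<in>root_set r. R p v w)"
    using sub[of r] by (cases "r = Leaf") auto
  ultimately show ?case by auto
qed simp

context
  fixes x :: "'a \<Rightarrow> real"
begin

definition len :: "'a \<Rightarrow> 'a \<Rightarrow> real" where
  "len u v = \<bar>x u - x v\<bar>"

text \<open>Chords of points in convex position cross exactly when their ends interleave. As edges
  are unordered pairs, this one pattern covers all interleavings.\<close>

definition uncrossed :: "'a set set \<Rightarrow> bool" where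
  "uncrossed E \<longleftrightarrow> (\<forall>u v w z. {u, v} \<in> E \<longrightarrow> {w, z} \<in> E \<longrightarrow>
     \<not> (x u < x w \<and> x w < x v \<and> x v < x z))"

definition lo :: "'a tree \<Rightarrow> real" where "lo t = Min (x ` set_tree t)"
definition hi :: "'a tree \<Rightarrow> real" where "hi t = Max (x ` set_tree t)"

text \<open>Membership in the hull, phrased by witnesses so that it is false for
  \<open>Leaf\<close>, where \<open>lo\<close> and \<open>hi\<close> have no meaning.\<close>

definition inside :: "'a \<Rightarrow> 'a tree \<Rightarrow> bool" where
  "inside c t \<longleftrightarrow> (\<exists>y\<in>set_tree t. x y \<le> x c) \<and> (\<exists>z\<in>set_tree t. x c \<le> x z)"

lemma uncrossed_subset: "uncrossed E \<Longrightarrow> F \<subseteq> E \<Longrightarrow> uncrossed F"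
  unfolding uncrossed_def by blast

lemma lo_le: "y \<in> set_tree t \<Longrightarrow> lo t \<le> x y"
  and hi_ge: "y \<in> set_tree t \<Longrightarrow> x y \<le> hi t"
  by (auto simp: lo_def hi_def)

lemma lo_attained: "t \<noteq> Leaf \<Longrightarrow> \<exists>y\<in>set_tree t. x y = lo t"
  and hi_attained: "t \<noteq> Leaf \<Longrightarrow> \<exists>y\<in>set_tree t. x y = hi t"
proof -
  assume "t \<noteq> Leaf"
  then have "x ` set_tree t \<noteq> {}" by (cases t) auto
  then have "Min (x ` set_tree t) \<in> x ` set_tree t" "Max (x ` set_tree t) \<in> x ` set_tree t"
    by (auto intro!: Min_in Max_in simp del: image_iff)
  then show "\<exists>y\<in>set_tree t. x y = lo t" "\<exists>y\<in>set_tree t. x y = hi t"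
    by (auto simp: lo_def hi_def)
qed

lemma len_le_width:
  "u \<in> set_tree t \<Longrightarrow> v \<in> set_tree t \<Longrightarrow> len u v \<le> hi t - lo t"
  using lo_le[of u t] lo_le[of v t] hi_ge[of u t] hi_ge[of v t] by (auto simp: len_def)

text \<open>A discrete intermediate value argument: on the path from the root to \<open>w\<close>
  some edge jumps over \<open>c\<close>, since no vertex lies at \<open>c\<close>.\<close>

lemma tree_edge_across:
  assumes "w \<in> set_tree (Node l v r)" "c \<notin> x ` set_tree (Node l v r)" "(x v < c) \<noteq> (x w < c)"
  shows "\<exists>y z. {y, z} \<in> tree_edges (Node l v r) \<and> x y < c \<and> c < x z"
proof -
  have "\<exists>y z. {y, z} \<in> tree_edges t \<and> x y < c \<and> c < x z"
    if "w \<in> set_tree t" "c \<notin> x ` set_tree t" "\<rho> \<in> root_set t" "(x \<rho> < c) \<noteq> (x w < c)" for t \<rho>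
    using that
  proof (induction t arbitrary: \<rho>)
    case (Node l' v' r')
    from Node.prems have [simp]: "\<rho> = v'" by simp
    have "w \<in> set_tree l' \<or> w \<in> set_tree r'" using Node.prems by auto
    then obtain s where s: "s = l' \<or> s = r'" "w \<in> set_tree s" by blast
    then obtain a b \<sigma> where sn: "s = Node a \<sigma> b" by (cases s) auto
    have \<sigma>: "\<sigma> \<in> root_set s" "\<sigma> \<in> set_tree s" "{v', \<sigma>} \<in> tree_edges (Node l' v' r')"
      using s sn by auto
    have sub: "tree_edges s \<subseteq> tree_edges (Node l' v' r')" using s by auto
    have c: "c \<notin> x ` set_tree s" "x \<sigma> \<noteq> c" "x v' \<noteq> c" using s \<sigma> Node.prems(2) by auto
    show ?case
    proof (cases "(x \<sigma> < c) = (x w < c)")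
      case False
      then have "\<exists>y z. {y, z} \<in> tree_edges s \<and> x y < c \<and> c < x z"
        using Node.IH s c \<sigma> by blast
      with sub show ?thesis by blast
    next
      case True
      then have "(x v' < c) \<noteq> (x \<sigma> < c)" using Node.prems by simp
      then show ?thesis using c \<sigma>(3) by (metis insert_commute linorder_less_linear)
    qed
  qed simp
  then show ?thesis using assms by (metis root_set.simps(2) singletonI)
qed

text \<open>Some edge of \<open>t\<close> passes over \<open>u\<close>. A \<open>w\<close> outside
  the hull would lie beyond one end of that edge, so the edge from \<open>u\<close> to
  \<open>w\<close> would interleave with it.\<close>

lemma inside_edge:
  assumes "uncrossed (insert {u, w} (tree_edges t))" "inside u t"
    and "x u \<notin> x ` set_tree t" "x w \<notin> x ` set_tree t"
  shows "inside w t"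
proof (rule ccontr)
  assume "\<not> inside w t"
  obtain y z where yz: "y \<in> set_tree t" "z \<in> set_tree t" "x y < x u" "x u < x z"
    using assms(2,3) unfolding inside_def by (metis image_eqI order_less_le)
  obtain l v r where t: "t = Node l v r" using yz by (cases t) auto
  \<comment> \<open>\<open>y\<close> and \<open>z\<close> lie on opposite sides of \<open>u\<close>,
    so the root is separated by \<open>u\<close> from one of them.\<close>
  obtain a b where ab: "{a, b} \<in> tree_edges t" "x a < x u" "x u < x b"
    using tree_edge_across[of y l v r "x u"] tree_edge_across[of z l v r "x u"] yz assms(3) t
    by (metis order_less_asym)
  have vs: "\<And>e. e \<in> tree_edges s \<Longrightarrow> e \<subseteq> set_tree s" for s :: "'a tree"
  proof (induction s)
    case (Node l v r)
    have "root_set l \<subseteq> set_tree l" "root_set r \<subseteq> set_tree r" by (cases l; simp) (cases r; simp)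
    with Node show ?case by auto
  qed simp
  have "a \<in> set_tree t" "b \<in> set_tree t" using vs[OF ab(1)] by auto
  then have "x w < x a \<or> x b < x w"
    using \<open>\<not> inside w t\<close> assms(4) unfolding inside_def by (meson not_le)
  moreover have "\<not> (x a < x u \<and> x u < x b \<and> x b < x w)"
    using assms(1) ab(1) unfolding uncrossed_def by blast
  moreover have "\<not> (x w < x a \<and> x a < x u \<and> x u < x b)"
    using assms(1) ab(1) unfolding uncrossed_def insert_commute[of u w] by blast
  ultimately show False using ab by blast
qed

text \<open>A tree cannot enter or leave the hull of a disjoint tree: \<open>inside_edge\<close> is
  applied in both directions to each edge from the root to \<open>w\<close>.\<close>

lemma inside_root_iff:
  assumes "uncrossed (tree_edges (Node l v r) \<union> tree_edges t)"
    and "x ` set_tree (Node l v r) \<inter> x ` set_tree t = {}" "w \<in> set_tree (Node l v r)"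
  shows "inside w t \<longleftrightarrow> inside v t"
proof -
  have "inside w t \<longleftrightarrow> inside \<rho> t"
    if "uncrossed (tree_edges s \<union> tree_edges t)" "x ` set_tree s \<inter> x ` set_tree t = {}"
      "w \<in> set_tree s" "\<rho> \<in> root_set s" for s \<rho>
    using that
  proof (induction s arbitrary: \<rho>)
    case (Node l' v' r')
    from Node.prems have [simp]: "\<rho> = v'" by simp
    show ?case
    proof (cases "w = v'")
      case False
      then obtain s where s: "s = l' \<or> s = r'" "w \<in> set_tree s" using Node.prems by auto
      then obtain a b \<sigma> where sn: "s = Node a \<sigma> b" by (cases s) auto
      have \<sigma>: "\<sigma> \<in> root_set s" "\<sigma> \<in> set_tree s" "{v', \<sigma>} \<in> tree_edges (Node l' v' r')"
        using s sn by auto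
      have "tree_edges s \<subseteq> tree_edges (Node l' v' r')" "set_tree s \<subseteq> set_tree (Node l' v' r')"
        using s by auto
      then have "uncrossed (tree_edges s \<union> tree_edges t)" "x ` set_tree s \<inter> x ` set_tree t = {}"
        using Node.prems uncrossed_subset by blast+
      then have 1: "inside w t \<longleftrightarrow> inside \<sigma> t" using Node.IH s \<sigma> by blast
      have e: "uncrossed (insert {v', \<sigma>} (tree_edges t))"
        using Node.prems(1) \<sigma>(3) by (rule_tac uncrossed_subset) auto
      have "x v' \<notin> x ` set_tree t" "x \<sigma> \<notin> x ` set_tree t"
        using Node.prems(2) \<sigma>(2) s by auto
      then have "inside v' t \<longleftrightarrow> inside \<sigma> t"
        using inside_edge[of v' \<sigma> t] inside_edge[of \<sigma> v' t] e by (auto simp: insert_commute)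
      with 1 show ?thesis by simp
    qed simp
  qed simp
  then show ?thesis using assms by (metis root_set.simps(2) singletonI)
qed

section \<open>Disjointness of the hulls of sibling subtrees\<close>

definition drawn :: "'a tree \<Rightarrow> bool" where
  "drawn t \<longleftrightarrow> distinct (inorder t) \<and> inj_on x (set_tree t) \<and> uncrossed (tree_edges t)"

text \<open>The parent \<open>p\<close> of the root of \<open>t\<close> enters through the auxiliary tree \<open>Node t p Leaf\<close>, which
  adds the edge above \<open>t\<close>.\<close>

definition planted :: "'a \<Rightarrow> 'a tree \<Rightarrow> bool" where
  "planted p t \<longleftrightarrow> drawn (Node t p Leaf) \<and> \<not> inside p t"

lemma drawn_Node_disjoint:
  assumes "drawn (Node l v r)"
  shows "x ` set_tree l \<inter> x ` set_tree r = {}" "x v \<notin> x ` set_tree l" "x v \<notin> x ` set_tree r"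
  using assms by (auto simp: drawn_def inj_on_def)

lemma drawn_subtree:
  assumes "drawn (Node l v r)"
  shows "drawn l" "drawn r" "drawn (Node l v Leaf)" "drawn (Node r v Leaf)"
proof -
  have "drawn s"
    if "set_tree s \<subseteq> set_tree (Node l v r)" "tree_edges s \<subseteq> tree_edges (Node l v r)"
      "distinct (inorder s)" for s
    using assms that uncrossed_subset[of "tree_edges (Node l v r)" "tree_edges s"]
      inj_on_subset[of x "set_tree (Node l v r)" "set_tree s"]
    unfolding drawn_def by (intro conjI) (elim conjE, assumption | blast)+
  note sub = this
  have "distinct (inorder (Node l v r))" using assms by (simp add: drawn_def)
  then show "drawn l" "drawn r" "drawn (Node l v Leaf)" "drawn (Node r v Leaf)"
    by (intro sub; auto)+
qed

text \<open>Removing one subtree leaves \<open>Node Leaf v r\<close> or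
  \<open>Node l v Leaf\<close>, a tree with root \<open>v\<close> to which
  \<open>inside_root_iff\<close> applies.\<close>

lemma inside_child_iff:
  assumes "drawn (Node l v r)"
  shows "w \<in> set_tree r \<Longrightarrow> inside w l \<longleftrightarrow> inside v l" "w \<in> set_tree l \<Longrightarrow> inside w r \<longleftrightarrow> inside v r"
proof -
  note d = drawn_Node_disjoint[OF assms]
  have u: "uncrossed (tree_edges (Node l v r))" using assms by (simp add: drawn_def)
  have "uncrossed (tree_edges (Node Leaf v r) \<union> tree_edges l)"
    using u by (rule uncrossed_subset) auto
  moreover have "uncrossed (tree_edges (Node l v Leaf) \<union> tree_edges r)"
    using u by (rule uncrossed_subset) auto
  ultimately show "w \<in> set_tree r \<Longrightarrow> inside w l \<longleftrightarrow> inside v l" "w \<in> set_tree l \<Longrightarrow> inside w r \<longleftrightarrow> inside v r"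
    using inside_root_iff[of Leaf v r l w] inside_root_iff[of l v Leaf r w] d by auto
qed

text \<open>If \<open>v\<close> lay in both hulls, each subtree would lie in the hull of the other.
  The hulls would then have the same left end, although the coordinates are disjoint.\<close>

lemma root_planted_child:
  assumes "drawn (Node l v r)"
  shows "planted v l \<or> planted v r"
proof (rule ccontr)
  assume "\<not> ?thesis"
  then have io: "inside v l" "inside v r"
    using drawn_subtree[OF assms] by (auto simp: planted_def)
  then have ne: "l \<noteq> Leaf" "r \<noteq> Leaf" by (auto simp: inside_def)
  obtain y z where yz: "y \<in> set_tree l" "x y = lo l" "z \<in> set_tree r" "x z = lo r"
    using lo_attained ne by metis
  then have "inside y r" "inside z l" using inside_child_iff[OF assms] io by auto
  then have "lo r \<le> lo l" "lo l \<le> lo r"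
    using yz lo_le unfolding inside_def by fastforce+
  then show False using yz drawn_Node_disjoint[OF assms] by (metis disjoint_iff image_eqI order_antisym)
qed

text \<open>If \<open>v\<close> lay in the hull of a subtree, then by the edge from \<open>v\<close>
  to \<open>p\<close> so would \<open>p\<close>, and \<open>p\<close> would lie in the hull of the
  whole tree.\<close>

lemma planted_children:
  assumes "planted p (Node l v r)"
  shows "planted v l" "planted v r"
proof -
  have d: "drawn (Node (Node l v r) p Leaf)" and p: "\<not> inside p (Node l v r)"
    using assms by (auto simp: planted_def)
  then have d': "drawn (Node l v r)" using drawn_subtree by blast
  have "\<not> inside v s" if s: "s = l \<or> s = r" for s
  proof
    assume v: "inside v s"
    have "uncrossed (insert {v, p} (tree_edges s))"
      using d s unfolding drawn_def
      by (elim conjE) (erule uncrossed_subset, auto)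
    moreover have "x v \<notin> x ` set_tree s" "x p \<notin> x ` set_tree s"
      using s drawn_Node_disjoint[OF d] drawn_Node_disjoint[OF d'] by auto
    ultimately have "inside p s" using v inside_edge by blast
    then show False using p s by (auto simp: inside_def)
  qed
  then show "planted v l" "planted v r"
    using drawn_subtree[OF d'] by (auto simp: planted_def)
qed

lemma planted_hull:
  assumes "planted p t" "t \<noteq> Leaf"
  shows "x p < lo t \<or> hi t < x p"
proof -
  obtain y z where "y \<in> set_tree t" "x y = lo t" "z \<in> set_tree t" "x z = hi t"
    using lo_attained hi_attained assms(2) by metis
  then show ?thesis using assms(1) unfolding planted_def inside_def by force
qed

text \<open>If the hulls met, the left end of one would lie in the other. By
  \<open>inside_child_iff\<close> so would \<open>v\<close>, which \<open>planted_children\<close>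
  forbids.\<close>

lemma planted_children_hulls:
  assumes "planted p (Node l v r)" "l \<noteq> Leaf" "r \<noteq> Leaf"
  shows "hi l < lo r \<or> hi r < lo l"
proof (rule ccontr)
  assume *: "\<not> ?thesis"
  have "drawn (Node (Node l v r) p Leaf)" using assms(1) by (simp add: planted_def)
  then have d: "drawn (Node l v r)" by (rule drawn_subtree)
  obtain y z y' z' where yz: "y \<in> set_tree l" "x y = lo l" "z \<in> set_tree r" "x z = lo r"
      "y' \<in> set_tree l" "x y' = hi l" "z' \<in> set_tree r" "x z' = hi r"
    using lo_attained hi_attained assms(2,3) by metis
  have "inside y r \<or> inside z l"
    using * yz unfolding inside_def by (smt (verit))
  then have "inside v r \<or> inside v l" using inside_child_iff[OF d] yz by blast
  then show False using planted_children[OF assms(1)] by (auto simp: planted_def)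
qed

text \<open>Disjoint intervals inside the interval of the parent. This superadditivity of the width
  drives both height bounds below.\<close>

lemma width_children:
  assumes "planted p (Node l v r)" "l \<noteq> Leaf" "r \<noteq> Leaf"
  shows "(hi l - lo l) + (hi r - lo r) \<le> hi (Node l v r) - lo (Node l v r)"
proof -
  have "lo (Node l v r) \<le> lo s \<and> hi s \<le> hi (Node l v r)" "lo s \<le> hi s" if s: "s = l \<or> s = r" for s
  proof -
    obtain y z where "y \<in> set_tree s" "x y = lo s" "z \<in> set_tree s" "x z = hi s"
      using lo_attained hi_attained assms(2,3) s by metis
    then show "lo (Node l v r) \<le> lo s \<and> hi s \<le> hi (Node l v r)" "lo s \<le> hi s"
      using lo_le[of _ "Node l v r"] hi_ge[of _ "Node l v r"] lo_le[of z s] s by force+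
  qed
  from this[of l] this[of r] planted_children_hulls[OF assms] show ?thesis by auto
qed

end

section \<open>Trees with growing edge lengths\<close>

text \<open>What the edge-ordering imposes on an increasing tree: going down, long edges may turn
  short but not conversely, and lengths do not shrink within a class.\<close>

definition lengthening :: "('a \<Rightarrow> real) \<Rightarrow> real \<Rightarrow> 'a \<Rightarrow> 'a \<Rightarrow> 'a \<Rightarrow> bool" where
  "lengthening x a u v w \<longleftrightarrow>
     (if len x u v \<le> a then len x v w \<le> a \<and> len x u v \<le> len x v w
      else len x v w \<le> a \<or> len x u v \<le> len x v w)"

text \<open>As \<open>p\<close> lies outside the hull, a child on the side of \<open>p\<close> would
  be closer to \<open>v\<close> than \<open>p\<close> is. So both subtrees lie beyond
  \<open>v\<close>, one hull after the other, and the edge to the farther child spans the nearer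
  hull.\<close>

lemma far_child_long:
  assumes pl: "planted x p (Node l v r)" and c: "c \<in> root_set l" and d: "d \<in> root_set r"
    and "len x p v \<le> len x v c" "len x p v \<le> len x v d"
  shows "hi x l - lo x l \<le> len x v d \<or> hi x r - lo x r \<le> len x v c"
proof -
  have cd: "c \<in> set_tree l" "d \<in> set_tree r" and ne: "l \<noteq> Leaf" "r \<noteq> Leaf"
    using c d by (cases l; cases r; auto)+
  have "lo x l \<le> x c" "x c \<le> hi x l" "lo x r \<le> x d" "x d \<le> hi x r"
    using lo_le hi_ge cd by metis+
  moreover have "x v < lo x l \<or> hi x l < x v" "x v < lo x r \<or> hi x r < x v"
    using planted_children[OF pl] planted_hull ne by metis+
  moreover have "x p < lo x (Node l v r) \<or> hi x (Node l v r) < x p"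
    using planted_hull[OF pl] by simp
  moreover have "lo x (Node l v r) \<le> x e \<and> x e \<le> hi x (Node l v r)" if "e \<in> {v, c, d}" for e
    using lo_le[of e "Node l v r" x] hi_ge[of e "Node l v r" x] that cd by auto
  moreover note planted_children_hulls[OF pl ne] assms(4,5)
  ultimately show ?thesis unfolding len_def by (smt (verit) insertCI)
qed

text \<open>The height \<open>k\<close> is held in reserve: a short edge would have to lead to a subtree of height at
  least \<open>k\<close>, which the last premise excludes. For \<open>a < 0\<close> every edge is long.\<close>

lemma lengthening_width:
  fixes V :: "'a set"
  assumes "complete t" "h + 3 + k \<le> height t" "planted x p t" "descending (lengthening x a) p t"
    and "w \<in> root_set t" "0 \<le> b" "b \<le> len x p w" "a < len x p w" "insert p (set_tree t) \<subseteq> V"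
    and long: "\<And>q s v. \<lbrakk>k \<le> height s; v \<in> root_set s; complete s; planted x q s;
        descending (lengthening x a) q s; insert q (set_tree s) \<subseteq> V\<rbrakk> \<Longrightarrow> a < len x q v"
  shows "b * 2 ^ (2 ^ h) \<le> hi x t - lo x t"
  using assms(1-9)
proof (induction h arbitrary: t p w b)
  case 0
  \<comment> \<open>For \<open>h = 0\<close> the factor is 2: each of the two disjoint child hulls
    contains an edge of length at least \<open>b\<close>.\<close>
  have one: "b \<le> hi x s - lo x s"
    if s: "complete s" "2 + k \<le> height s" "planted x q s" "descending (lengthening x a) q s"
      "u \<in> root_set s" "b \<le> len x q u" "a < len x q u" "insert q (set_tree s) \<subseteq> V" for q s u
  proof -
    obtain l r where [simp]: "s = Node l u r" using s by (cases s) auto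
    obtain l1 c l2 where l: "l = Node l1 c l2" using s by (cases l) auto
    have "a < len x u c"
      using s l planted_children(1)[of x q l u r] by (intro long[of l]) auto
    moreover have "lengthening x a q u c" using s l by simp
    ultimately have "len x q u \<le> len x u c" using s by (simp add: lengthening_def)
    moreover have "len x u c \<le> hi x s - lo x s" using l by (intro len_le_width) auto
    ultimately show ?thesis using s by linarith
  qed
  obtain l r where t: "t = Node l w r" using 0 by (cases t) auto
  have "b \<le> hi x s - lo x s" if s: "s = l \<or> s = r" for s
  proof -
    obtain s1 c s2 where sn: "s = Node s1 c s2" using s 0 t by (cases s) auto
    have ps: "complete s" "2 + k \<le> height s" "planted x w s" "descending (lengthening x a) w s"
      "insert w (set_tree s) \<subseteq> V"
      using s 0 t planted_children[of x p l w r] by auto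
    then have "a < len x w c" using sn by (intro long) auto
    moreover have "lengthening x a p w c" using s sn 0 t by auto
    ultimately have "b \<le> len x w c" using 0 by (simp add: lengthening_def)
    from one[OF ps(1-4) _ this _ ps(5)] show ?thesis using \<open>a < len x w c\<close> sn by simp
  qed
  from this[of l] this[of r] have "2 * b \<le> (hi x l - lo x l) + (hi x r - lo x r)" by simp
  also have "\<dots> \<le> hi x t - lo x t"
    using 0 t by (simp only: t, intro width_children) (auto simp: t)
  finally show ?case by simp
next
  case (Suc h)
  obtain l r where t: "t = Node l w r" using Suc.prems by (cases t) auto
  obtain l1 c l2 where l: "l = Node l1 c l2" using Suc.prems t by (cases l) auto
  obtain r1 d r2 where r: "r = Node r1 d r2" using Suc.prems t by (cases r) auto
  have ps: "complete s" "h + 3 + k \<le> height s" "planted x w s" "descending (lengthening x a) w s"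
    "insert w (set_tree s) \<subseteq> V" if "s = l \<or> s = r" for s
    using that Suc.prems t planted_children[of x p l w r] by auto
  have "a < len x w c" using ps[of l] l by (intro long[of l]) auto
  moreover have "a < len x w d" using ps[of r] r by (intro long[of r]) auto
  moreover have "lengthening x a p w c" "lengthening x a p w d"
    using Suc.prems t l r by auto
  ultimately have cd: "len x p w \<le> len x w c" "len x p w \<le> len x w d" "a < len x w c" "a < len x w d"
    using Suc.prems by (auto simp: lengthening_def)
  have wl: "\<beta> * 2 ^ (2 ^ h) \<le> hi x l - lo x l" if "0 \<le> \<beta>" "\<beta> \<le> len x w c" for \<beta>
    using Suc.IH[of l w c \<beta>] ps[of l] that cd l by simp
  have wr: "\<beta> * 2 ^ (2 ^ h) \<le> hi x r - lo x r" if "0 \<le> \<beta>" "\<beta> \<le> len x w d" for \<beta>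
    using Suc.IH[of r w d \<beta>] ps[of r] that cd r by simp
  \<comment> \<open>Both subtrees are at least \<open>W\<close> wide, so by
    \<open>far_child_long\<close> one of the two child edges has length at least \<open>W\<close>.
    The induction hypothesis for that child, with \<open>W\<close> in place of \<open>b\<close>,
    squares the factor.\<close>
  define W where "W = b * 2 ^ (2 ^ h)"
  have W: "0 \<le> W" "W \<le> hi x l - lo x l" "W \<le> hi x r - lo x r"
    using wl[of b] wr[of b] Suc.prems cd by (auto simp: W_def)
  have "hi x l - lo x l \<le> len x w d \<or> hi x r - lo x r \<le> len x w c"
    using far_child_long[of x p l w r c d] Suc.prems t l r cd by simp
  then have "W * 2 ^ (2 ^ h) \<le> (hi x l - lo x l) + (hi x r - lo x r)"
    using wr[of W] wl[of W] W by linarith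
  also have "\<dots> \<le> hi x t - lo x t"
    using Suc.prems t l r by (simp only: t, intro width_children) auto
  finally show ?case by (simp add: W_def mult_2 power_add mult.assoc)
qed

lemma planted_root_neq: "planted x p t \<Longrightarrow> v \<in> root_set t \<Longrightarrow> p \<noteq> v \<and> v \<in> set_tree t"
  by (cases t) (auto simp: planted_def drawn_def)

text \<open>The height is split into two parts of \<open>h + 3\<close> levels. A short edge above a
  subtree of height at least \<open>h + 3\<close> would make that subtree consist of short edges of
  growing length, hence too wide. So the edges of the upper part are long and growing, and the same
  width bound applies to them.\<close>

lemma lengthening_height:
  fixes V :: "'a set"
  assumes "complete t" "2 * h + 6 \<le> height t" "planted x p t" "descending (lengthening x a) p t"
    and V: "insert p (set_tree t) \<subseteq> V"
    and sep: "\<And>u v. u \<in> V \<Longrightarrow> v \<in> V \<Longrightarrow> u \<noteq> v \<Longrightarrow> 1 \<le> len x u v"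
    and diam: "\<And>u v. u \<in> V \<Longrightarrow> v \<in> V \<Longrightarrow> len x u v \<le> D"
  shows "2 ^ (2 ^ h) \<le> D"
proof (rule ccontr)
  assume contra: "\<not> 2 ^ (2 ^ h) \<le> D"
  have small: "hi x s - lo x s < 2 ^ (2 ^ h)" if s: "set_tree s \<subseteq> V" "s \<noteq> Leaf" for s
  proof -
    obtain y z where "y \<in> set_tree s" "x y = lo x s" "z \<in> set_tree s" "x z = hi x s"
      using lo_attained hi_attained s(2) by metis
    then have "hi x s - lo x s \<le> D" using diam[of z y] s(1) by (force simp: len_def)
    then show ?thesis using contra by linarith
  qed
  have long: "a < len x q v"
    if s: "h + 3 \<le> height s" "v \<in> root_set s" "complete s" "planted x q s"
      "descending (lengthening x a) q s" "insert q (set_tree s) \<subseteq> V" for q s v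
  proof (rule ccontr)
    assume "\<not> a < len x q v"
    then have short: "\<forall>v\<in>root_set s. len x q v \<le> a" using s by (cases s) auto
    \<comment> \<open>All edges below a short edge are short, so lengths grow throughout. The
      threshold \<open>- 1\<close> expresses plain growth.\<close>
    have "descending (lengthening x (- 1)) q s" using s(5) short
    proof (induction s arbitrary: q)
      case (Node l u r)
      then show ?case by (auto simp: lengthening_def len_def)
    qed simp
    moreover have "1 \<le> len x q v" using s planted_root_neq[of x q s v] sep[of q v] by auto
    ultimately have "1 * 2 ^ (2 ^ h) \<le> hi x s - lo x s"
      using s by (intro lengthening_width[where k = 0 and a = "- 1" and w = v and p = q and V = V])
        (auto simp: len_def)
    moreover have "s \<noteq> Leaf" using s by auto
    ultimately show False using small[of s] s by auto
  qed
  obtain l w r where t: "t = Node l w r" using assms(2) by (cases t) auto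
  have "a < len x p w" using assms t by (intro long[of t]) auto
  moreover have "1 \<le> len x p w" using assms t planted_root_neq[of x p t w] sep[of p w] by auto
  ultimately have "1 * 2 ^ (2 ^ h) \<le> hi x t - lo x t"
    using assms t long
    by (intro lengthening_width[where k = "h + 3" and a = a and w = w and p = p and V = V]) auto
  then show False using small[of t] V t by auto
qed

section \<open>Trees with short edges before long edges\<close>

definition staying_long :: "('a \<Rightarrow> real) \<Rightarrow> real \<Rightarrow> 'a \<Rightarrow> 'a \<Rightarrow> 'a \<Rightarrow> bool" where
  "staying_long x a u v w \<longleftrightarrow> (a < len x u v \<longrightarrow> a < len x v w)"

text \<open>If \<open>staying_long\<close> holds along the tree, these are the vertices reached by short edges only.\<close>

fun short_part :: "('a \<Rightarrow> real) \<Rightarrow> real \<Rightarrow> 'a \<Rightarrow> 'a tree \<Rightarrow> 'a set" where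
  "short_part x a p Leaf = {}"
| "short_part x a p (Node l v r) =
     (if len x p v \<le> a then {v} else {}) \<union> short_part x a v l \<union> short_part x a v r"

lemma short_part_subset: "short_part x a p t \<subseteq> set_tree t"
  by (induction t arbitrary: p) auto

lemma short_part_empty:
  "descending (staying_long x a) p t \<Longrightarrow> \<forall>v\<in>root_set t. a < len x p v \<Longrightarrow> short_part x a p t = {}"
  by (induction t arbitrary: p) (auto simp: staying_long_def)

text \<open>Nothing below a long edge belongs to the short part, so \<open>w\<close> is reached by
  at most \<open>height t\<close> edges, each of length at most \<open>a\<close>.\<close>

lemma short_part_near_root:
  assumes "descending (staying_long x a) p t" "w \<in> short_part x a p t" "0 \<le> a"
  shows "len x p w \<le> a * height t"
  using assms(1,2)
proof (induction t arbitrary: p)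
  case (Node l v r)
  have short: "len x p v \<le> a"
  proof (rule ccontr)
    assume "\<not> len x p v \<le> a"
    then have "\<forall>u\<in>root_set l \<union> root_set r. a < len x v u"
      using Node.prems by (auto simp: staying_long_def)
    then have "short_part x a v l = {}" "short_part x a v r = {}"
      using Node.prems by (auto intro!: short_part_empty)
    then show False using Node.prems \<open>\<not> len x p v \<le> a\<close> by simp
  qed
  show ?case
  proof (cases "w = v")
    case True
    have "a * 1 \<le> a * height (Node l v r)" using assms(3) by (intro mult_left_mono) auto
    then show ?thesis using True short by simp
  next
    case False
    then obtain s where s: "s = l \<or> s = r" "w \<in> short_part x a v s"
      using Node.prems short by auto
    then have "len x v w \<le> a * height s" using Node by auto
    also have "\<dots> \<le> a * (real (height (Node l v r)) - 1)"
      using s assms(3) by (intro mult_left_mono) auto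
    finally have "len x v w \<le> a * (real (height (Node l v r)) - 1)" .
    moreover have "len x p w \<le> len x p v + len x v w" by (simp add: len_def)
    ultimately show ?thesis using short by (simp add: algebra_simps)
  qed
qed simp

text \<open>Each of the \<open>2 ^ (height t - 2)\<close> lowest cherries accounts for
  \<open>a\<close>: either its root is in the short part, or its edges are long and its hull is
  wider than \<open>a\<close>. Widths and short parts of sibling subtrees add up.\<close>

lemma staying_long_height:
  assumes "complete t" "2 \<le> height t" "planted x p t" "descending (staying_long x a) p t" "0 \<le> a"
  shows "a * 2 ^ (height t - 2) \<le> (hi x t - lo x t) + a * card (short_part x a p t)"
  using assms(1-4)
proof (induction t arbitrary: p)
  case (Node l v r)
  have fin: "finite (short_part x a q s)" for q s
    using short_part_subset finite_subset finite_set_tree by metis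
  have hl: "height (Node l v r) = Suc (height l)" "height l = height r" using Node.prems by auto
  then obtain l1 c l2 where l: "l = Node l1 c l2" using Node.prems by (cases l) auto
  show ?case
  proof (cases "height l = 1")
    case True
    have w: "len x v c \<le> hi x (Node l v r) - lo x (Node l v r)" using l by (intro len_le_width) auto
    have "a \<le> (hi x (Node l v r) - lo x (Node l v r)) + a * card (short_part x a p (Node l v r))"
    proof (cases "len x p v \<le> a")
      case True
      then have "v \<in> short_part x a p (Node l v r)" by simp
      then have "1 \<le> card (short_part x a p (Node l v r))"
        using fin by (metis One_nat_def Suc_leI card_gt_0_iff empty_iff)
      then have "a * 1 \<le> a * card (short_part x a p (Node l v r))"
        using assms(5) by (intro mult_left_mono) auto
      then show ?thesis using w by (simp add: len_def)
    next
      case False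
      then have "a < len x v c" using Node.prems l by (auto simp: staying_long_def)
      moreover have "0 \<le> a * card (short_part x a p (Node l v r))" using assms(5) by simp
      ultimately show ?thesis using w by linarith
    qed
    then show ?thesis using True hl by simp
  next
    case False
    then have h2: "2 \<le> height l" "r \<noteq> Leaf" using hl Node.prems by auto
    have dis: "set_tree l \<inter> set_tree r = {}"
      using Node.prems by (auto simp: planted_def drawn_def)
    have "card (short_part x a v l) + card (short_part x a v r)
        = card (short_part x a v l \<union> short_part x a v r)"
      using dis short_part_subset[of x a v l] short_part_subset[of x a v r] fin
      by (intro card_Un_disjoint[symmetric]) auto
    also have "\<dots> \<le> card (short_part x a p (Node l v r))"
      by (rule card_mono[OF fin]) auto
    finally have "a * (card (short_part x a v l) + card (short_part x a v r))
        \<le> a * card (short_part x a p (Node l v r))"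
      using assms(5) by (intro mult_left_mono) auto
    moreover have "a * 2 ^ (height l - 2) \<le> (hi x l - lo x l) + a * card (short_part x a v l)"
      using Node h2 planted_children[of x p l v r] by (intro Node.IH(1)) auto
    moreover have "a * 2 ^ (height r - 2) \<le> (hi x r - lo x r) + a * card (short_part x a v r)"
      using Node h2 hl planted_children[of x p l v r] by (intro Node.IH(2)) auto
    moreover have "(hi x l - lo x l) + (hi x r - lo x r) \<le> hi x (Node l v r) - lo x (Node l v r)"
      using Node.prems l h2 by (intro width_children) auto
    moreover have "a * 2 ^ (height (Node l v r) - 2) = a * 2 ^ (height l - 2) + a * 2 ^ (height r - 2)"
      using h2(1) hl by (cases "height l" rule: nat.exhaust; cases "height l - 1") auto
    ultimately show ?thesis by (simp only: distrib_left of_nat_add)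
  qed
qed simp

lemma card_separated:
  assumes "inj_on x S" "x ` S \<subseteq> \<int>" "\<And>w. w \<in> S \<Longrightarrow> \<bar>c - x w\<bar> \<le> d" "0 \<le> d"
  shows "real (card S) \<le> 2 * d + 1"
proof -
  have "inj_on (\<lambda>w. \<lfloor>x w\<rfloor>) S"
  proof (rule inj_onI)
    fix u v assume "u \<in> S" "v \<in> S" "\<lfloor>x u\<rfloor> = \<lfloor>x v\<rfloor>"
    moreover have "x u = of_int \<lfloor>x u\<rfloor>" "x v = of_int \<lfloor>x v\<rfloor>"
      using calculation assms(2) by (auto simp: floor_of_int elim!: Ints_cases dest!: image_subset_iff[THEN iffD1])
    ultimately show "u = v" using assms(1) by (metis inj_onD)
  qed
  moreover have "(\<lambda>w. \<lfloor>x w\<rfloor>) ` S \<subseteq> {\<lceil>c - d\<rceil>..\<lfloor>c + d\<rfloor>}"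
  proof safe
    fix w assume w: "w \<in> S"
    then obtain k where "x w = of_int k" using assms(2) by (auto elim!: Ints_cases)
    then show "\<lfloor>x w\<rfloor> \<in> {\<lceil>c - d\<rceil>..\<lfloor>c + d\<rfloor>}"
      using assms(3)[OF w] by (auto simp: ceiling_le_iff le_floor_iff abs_le_iff)
  qed
  ultimately have "card S \<le> card {\<lceil>c - d\<rceil>..\<lfloor>c + d\<rfloor>}"
    by (metis card_image card_mono finite_atLeastAtMost_int)
  also have "\<dots> = nat (\<lfloor>c + d\<rfloor> + 1 - \<lceil>c - d\<rceil>)" by simp
  finally have "real (card S) \<le> real (nat (\<lfloor>c + d\<rfloor> + 1 - \<lceil>c - d\<rceil>))" by linarith
  then show ?thesis using assms(4) by linarith
qed

text \<open>\<open>staying_long_height\<close> divided by \<open>a\<close>. The short part is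
  counted by its coordinates, which are distinct integers near \<open>x p\<close>.\<close>

lemma staying_long_size:
  fixes V :: "'a set"
  assumes "complete t" "2 \<le> height t" "planted x p t" "descending (staying_long x a) p t" "0 < a"
    and V: "insert p (set_tree t) \<subseteq> V" "x ` V \<subseteq> \<int>" "inj_on x V"
    and diam: "\<And>u v. u \<in> V \<Longrightarrow> v \<in> V \<Longrightarrow> len x u v \<le> D"
  shows "2 ^ (height t - 2) \<le> D / a + 2 * (a * height t) + 1"
proof -
  have "t \<noteq> Leaf" using assms(2) by auto
  then obtain y z where "y \<in> set_tree t" "x y = lo x t" "z \<in> set_tree t" "x z = hi x t"
    using lo_attained hi_attained by metis
  then have w: "hi x t - lo x t \<le> D" using diam[of z y] V(1) by (force simp: len_def)
  have sub: "short_part x a p t \<subseteq> V" using short_part_subset V(1) by fastforce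
  have "real (card (short_part x a p t)) \<le> 2 * (a * height t) + 1"
  proof (rule card_separated)
    show "inj_on x (short_part x a p t)" using sub V(3) inj_on_subset by blast
    show "x ` short_part x a p t \<subseteq> \<int>" using sub V(2) by blast
    show "\<bar>x p - x u\<bar> \<le> a * height t" if "u \<in> short_part x a p t" for u
      using short_part_near_root[OF assms(4) that] assms(5) by (simp add: len_def)
  qed (use assms(5) in simp)
  then have "a * card (short_part x a p t) \<le> a * (2 * (a * height t) + 1)"
    using assms(5) by (intro mult_left_mono) auto
  moreover have "a * 2 ^ (height t - 2) \<le> (hi x t - lo x t) + a * card (short_part x a p t)"
    using assms by (intro staying_long_height) auto
  ultimately have "a * 2 ^ (height t - 2) \<le> D + a * (2 * (a * height t) + 1)" using w by linarith
  also have "\<dots> = a * (D / a + 2 * (a * height t) + 1)" using assms(5) by (simp add: field_simps)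
  finally show ?thesis using assms(5) by simp
qed

section \<open>Points on a parabola\<close>

definition parabola :: "real \<Rightarrow> point" where "parabola s = (s, s\<^sup>2)"

lemma parabola_not_collinear:
  assumes "s \<noteq> t" "t \<noteq> u" "s \<noteq> u"
  shows "\<not> collinear {parabola s, parabola t, parabola u}"
proof
  assume "collinear {parabola s, parabola t, parabola u}"
  then obtain d where d: "\<And>y z. y \<in> {parabola s, parabola t, parabola u} \<Longrightarrow>
      z \<in> {parabola s, parabola t, parabola u} \<Longrightarrow> \<exists>c. y - z = c *\<^sub>R d"
    unfolding collinear_def by blast
  obtain c1 c2 where "parabola t - parabola s = c1 *\<^sub>R d" "parabola u - parabola s = c2 *\<^sub>R d"
    using d[of "parabola t" "parabola s"] d[of "parabola u" "parabola s"] by blast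
  then have "t - s = c1 * fst d" "t\<^sup>2 - s\<^sup>2 = c1 * snd d" "u - s = c2 * fst d" "u\<^sup>2 - s\<^sup>2 = c2 * snd d"
    by (auto simp: parabola_def prod_eq_iff)
  \<comment> \<open>The determinant of the two difference vectors vanishes; it factors as a
    Vandermonde product.\<close>
  then have "(t - s) * (u\<^sup>2 - s\<^sup>2) = (u - s) * (t\<^sup>2 - s\<^sup>2)" by (simp add: algebra_simps)
  then have "(t - s) * (u - s) * (u - t) = 0" by (simp add: algebra_simps power2_eq_square)
  then show False using assms by simp
qed

lemma parabola_chord:
  assumes "s < X" "X < t"
  shows "(X, (s + t) * X - s * t) \<in> open_segment (parabola s) (parabola t)"
proof -
  define \<mu> where "\<mu> = (X - s) / (t - s)"
  have \<mu>: "0 < \<mu>" "\<mu> < 1" using assms by (auto simp: \<mu>_def)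
  have X: "X = (1 - \<mu>) * s + \<mu> * t"
  proof -
    have "\<mu> * (t - s) = X - s" using assms by (simp add: \<mu>_def)
    then show ?thesis by (simp add: algebra_simps)
  qed
  have "(X, (s + t) * X - s * t) = (1 - \<mu>) *\<^sub>R parabola s + \<mu> *\<^sub>R parabola t"
    by (simp add: parabola_def X algebra_simps power2_eq_square)
  moreover have "parabola s \<noteq> parabola t" using assms by (simp add: parabola_def)
  ultimately show ?thesis using \<mu> by (auto simp: in_segment)
qed

lemma parabola_crosses:
  assumes "s < u" "u < t" "t < v"
  shows "crosses {parabola s, parabola t} {parabola u, parabola v}"
proof -
  define d where "d = u + v - s - t"
  \<comment> \<open>\<open>X\<close> solves
    \<open>(s + t) * X - s * t = (u + v) * X - u * v\<close>: it is the abscissa where the two chord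
    lines meet. The factorizations below place it strictly between \<open>u\<close> and
    \<open>t\<close>, hence on both chords.\<close>
  define X where "X = (u * v - s * t) / d"
  have d: "0 < d" using assms by (simp add: d_def)
  have Xd: "X * d = u * v - s * t" using d by (simp add: X_def)
  have "(X - u) * d = (u - s) * (t - u)" "(t - X) * d = (t - u) * (v - t)"
    using Xd by (simp_all add: d_def algebra_simps)
  moreover have "0 < (u - s) * (t - u)" "0 < (t - u) * (v - t)" using assms by simp_all
  ultimately have X: "u < X" "X < t" using d by (metis diff_gt_0_iff_gt zero_less_mult_pos2)+
  have eq: "(s + t) * X - s * t = (u + v) * X - u * v" using Xd by (simp add: d_def algebra_simps)
  have "(X, (s + t) * X - s * t) \<in> open_segment (parabola s) (parabola t)"
    "(X, (s + t) * X - s * t) \<in> open_segment (parabola u) (parabola v)"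
    using parabola_chord[of s X t] parabola_chord[of u X v] X assms by (simp_all add: eq)
  moreover have "{parabola s, parabola t} \<noteq> {parabola u, parabola v}"
    using assms by (auto simp: doubleton_eq_iff parabola_def)
  ultimately show ?thesis unfolding crosses_def by blast
qed

definition parabola_points :: "nat \<Rightarrow> point set" where
  "parabola_points n = (\<lambda>i. parabola (real i)) ` {..<n}"

definition parabola_drawing :: "nat \<Rightarrow> point ugraph" where
  "parabola_drawing n = (parabola_points n, [parabola_points n]\<^bsup>2\<^esup>)"

lemma parabola_fst: "p \<in> parabola_points n \<Longrightarrow> p = parabola (fst p)"
  by (auto simp: parabola_points_def parabola_def)

lemma card_parabola_points: "card (parabola_points n) = n" "finite (parabola_points n)"
  unfolding parabola_points_def
  by (auto simp: card_image inj_on_def parabola_def)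

lemma inj_on_fst_parabola_points: "inj_on fst (parabola_points n)"
  by (metis inj_onI parabola_fst)

lemma fst_parabola_points_Ints: "fst ` parabola_points n \<subseteq> \<int>"
  by (auto simp: parabola_points_def parabola_def)

lemma len_parabola_points:
  assumes "u \<in> parabola_points n" "v \<in> parabola_points n"
  shows "len fst u v < n" "u \<noteq> v \<Longrightarrow> 1 \<le> len fst u v"
  using assms by (auto simp: parabola_points_def parabola_def len_def)

lemma parabola_drawing_in_drawings: "parabola_drawing n \<in> drawings (complete_ugraph n)"
proof -
  let ?f = "\<lambda>i. parabola (real i)"
  have inj: "inj_on ?f A" for A by (auto simp: inj_on_def parabola_def)
  have "[?f ` {..<n}]\<^bsup>2\<^esup> = (\<lambda>e. ?f ` e) ` [{..<n}]\<^bsup>2\<^esup>"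
  proof (intro equalityI subsetI)
    fix e assume "e \<in> [?f ` {..<n}]\<^bsup>2\<^esup>"
    then have "e \<subseteq> ?f ` {..<n}" "finite e" "card e = 2" by (auto simp: nsets_def)
    then obtain e' where e': "e' \<subseteq> {..<n}" "e = ?f ` e'" by (meson subset_imageE)
    then have "finite e'" "card e' = 2"
      using \<open>card e = 2\<close> card_image[OF inj, of e'] finite_subset by auto
    with e' show "e \<in> (\<lambda>e. ?f ` e) ` [{..<n}]\<^bsup>2\<^esup>" by (auto simp: nsets_def)
  next
    fix e assume "e \<in> (\<lambda>e. ?f ` e) ` [{..<n}]\<^bsup>2\<^esup>"
    then show "e \<in> [?f ` {..<n}]\<^bsup>2\<^esup>" by (auto simp: nsets_def card_image[OF inj])
  qed
  then have "isomorphic (complete_ugraph n) (parabola_drawing n)"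
    unfolding isomorphic_def complete_ugraph_def parabola_drawing_def parabola_points_def
    using inj by (auto simp: bij_betw_def intro!: exI[of _ ?f])
  moreover have "general_position (parabola_points n)"
    unfolding general_position_def
  proof (intro ballI impI)
    fix a b c assume "a \<in> parabola_points n" "b \<in> parabola_points n" "c \<in> parabola_points n"
      and "a \<noteq> b \<and> b \<noteq> c \<and> a \<noteq> c"
    then show "\<not> collinear {a, b, c}"
      using parabola_not_collinear[of "fst a" "fst b" "fst c"] by (metis parabola_fst)
  qed
  ultimately show ?thesis
    by (simp add: drawings_def geometric_graph_def simple_graph_def parabola_drawing_def
        card_parabola_points)
qed

text \<open>By \<open>parabola_crosses\<close>, interleaving edges on the parabola cross; this makes
  the hull arguments available with \<open>fst\<close> for \<open>x\<close>.\<close>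

lemma drawn_if_noncrossing:
  assumes "noncrossing_tree t" "set_tree t \<subseteq> parabola_points n" "distinct (inorder t)"
    "tree_edges t \<subseteq> [parabola_points n]\<^bsup>2\<^esup>"
  shows "drawn fst t"
  unfolding drawn_def uncrossed_def
proof (intro conjI allI impI notI)
  show "inj_on fst (set_tree t)" using inj_on_fst_parabola_points inj_on_subset assms(2) by blast
  fix u v w z assume e: "{u, v} \<in> tree_edges t" "{w, z} \<in> tree_edges t"
    and "fst u < fst w \<and> fst w < fst v \<and> fst v < fst z"
  then have "crosses {parabola (fst u), parabola (fst v)} {parabola (fst w), parabola (fst z)}"
    by (intro parabola_crosses) auto
  moreover have "u \<in> parabola_points n" "v \<in> parabola_points n" "w \<in> parabola_points n"
    "z \<in> parabola_points n"
    using e assms(4) by (auto simp: nsets_def)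
  ultimately show False using e assms(1) by (metis noncrossing_tree_def parabola_fst)
qed (use assms in simp)

section \<open>The edge-ordering\<close>

text \<open>Sort by key and break ties by an injective numbering; because of the ties only a weak
  inequality of keys can be read off.\<close>

lemma linear_order_refining:
  fixes k :: "'a \<Rightarrow> 'b :: linorder"
  assumes "finite E"
  obtains r where "linear_order_on E r" "\<And>e f. less_in r e f \<Longrightarrow> k e \<le> k f"
proof -
  obtain g :: "'a \<Rightarrow> nat" where g: "inj_on g E"
    using finite_imp_inj_to_nat_seg[OF assms] by blast
  define r where "r = {(e, f). e \<in> E \<and> f \<in> E \<and> (k e < k f \<or> k e = k f \<and> g e \<le> g f)}"
  have "linear_order_on E r"
    unfolding order_on_defs refl_on_def trans_def antisym_def total_on_def r_def
    using g by (auto dest: inj_onD)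
  moreover have "less_in r e f \<Longrightarrow> k e \<le> k f" for e f
    by (auto simp: less_in_def r_def)
  ultimately show ?thesis using that by blast
qed

definition edge_len :: "point set \<Rightarrow> real" where
  "edge_len e = Max (fst ` e) - Min (fst ` e)"

lemma edge_len_pair: "edge_len {u, v} = len fst u v"
  by (auto simp: edge_len_def len_def max_def min_def)

text \<open>When all lengths lie in \<open>[0, N)\<close>, short edges get keys at most \<open>- N\<close> and long ones keys above
  \<open>- N\<close>.\<close>

definition shifted_key :: "real \<Rightarrow> real \<Rightarrow> real \<Rightarrow> real" where
  "shifted_key N a d = (if d \<le> a then - N - d else - d)"

text \<open>One level is given up: the root becomes the parent \<open>p\<close> of a planted child
  subtree, to which the height bounds apply.\<close>

lemma root_child_descending:
  assumes "complete t" "2 \<le> height t" "drawn x t"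
    and "\<forall>q\<in>root_leaf_paths t. \<forall>i. i + 2 < length q \<longrightarrow> R (q ! i) (q ! (i + 1)) (q ! (i + 2))"
  obtains p s where "complete s" "height t = Suc (height s)" "planted x p s"
    "descending R p s" "insert p (set_tree s) \<subseteq> set_tree t"
proof -
  obtain l v r where t: "t = Node l v r" using assms(2) by (cases t) auto
  have "planted x v l \<or> planted x v r" using root_planted_child[of x l v r] assms(3) t by simp
  then obtain s where s: "s = l \<or> s = r" "planted x v s" by blast
  have h: "complete s" "height t = Suc (height s)" using s t assms(1) by auto
  then have "s \<noteq> Leaf" using assms(2) by auto
  then have "v # q \<in> root_leaf_paths t" if "q \<in> root_leaf_paths s" for q
    using s(1) t that by auto
  then have "descending R v s"
    using assms(4) by (intro descending_if_paths) blast
  then show ?thesis using that s h t by auto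
qed

section \<open>Size bound for monotone trees on the parabola\<close>

lemma ln_cube_le:
  fixes y :: real
  assumes "1 \<le> y"
  shows "(ln y) ^ 3 \<le> 27 * y"
proof -
  have "ln y / 3 \<le> exp (ln y / 3)" using exp_ge_add_one_self[of "ln y / 3"] by linarith
  then have "(ln y / 3) ^ 3 \<le> exp (ln y / 3) ^ 3" using assms by (intro power_mono) auto
  also have "\<dots> = y" using assms by (simp flip: exp_of_nat_mult)
  finally show ?thesis by (simp add: power_divide)
qed

lemma parabola_tree_size:
  assumes n: "2 \<le> n" and r: "\<And>e f. less_in r e f \<Longrightarrow>
      shifted_key n (sqrt (n / ln n)) (edge_len e) \<le> shifted_key n (sqrt (n / ln n)) (edge_len f)"
    and t: "t \<in> noncrossing_monotone_trees (parabola_drawing n) r"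
  shows "real (size t) \<le> 10000 * sqrt (n * ln n)"
proof -
  let ?V = "parabola_points n"
  define L where "L = ln (real n)"
  define a where "a = sqrt (real n / L)"
  define B where "B = sqrt (real n * L)"
  have L: "1 / 2 \<le> L"
  proof -
    have "1 / 2 \<le> ln (2 :: real)" using ln2_ge_two_thirds by simp
    also have "\<dots> \<le> L" using n by (simp add: L_def)
    finally show ?thesis .
  qed
  have a: "0 < a" using L n by (simp add: a_def)
  have B1: "1 \<le> B"
  proof -
    have "2 * (1 / 2) \<le> real n * L" using n L by (intro mult_mono) auto
    then show ?thesis by (simp add: B_def)
  qed
  \<comment> \<open>The choice of \<open>a\<close> balances the two terms of
    \<open>staying_long_size\<close>.\<close>
  have aL: "a * L = B" "real n / a = B"
    using L n by (auto simp: a_def B_def real_sqrt_divide real_sqrt_mult field_simps)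
  have tt: "complete t" "distinct (inorder t)" "set_tree t \<subseteq> ?V" "tree_edges t \<subseteq> [?V]\<^bsup>2\<^esup>"
    "noncrossing_tree t" "monotone_tree r t" "t \<noteq> Leaf"
    using t by (auto simp: noncrossing_monotone_trees_def complete_binary_tree_in_def parabola_drawing_def)
  have size: "real (size t) = 2 ^ height t - 1"
    using size_if_complete[OF tt(1)] by (simp add: of_nat_diff)
  have "size t = card (set_tree t)"
    using distinct_card[OF tt(2)] by simp
  also have "\<dots> \<le> n" using card_mono[OF card_parabola_points(2) tt(3)] by (simp add: card_parabola_points)
  finally have "size t \<le> n" .
  \<comment> \<open>From \<open>2 ^ height t <= 2 * n\<close> and
    \<open>1 / 2 <= ln 2 <= L\<close>.\<close>
  have H: "height t \<le> 4 * L"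
  proof -
    have "2 ^ height t \<le> 2 * real n" using size \<open>size t \<le> n\<close> n by linarith
    then have "ln (2 ^ height t) \<le> ln (2 * real n)" using n by simp
    then have "height t * ln 2 \<le> ln 2 + L" using n by (simp add: ln_realpow ln_mult L_def)
    moreover have "height t * (1 / 2) \<le> height t * ln (2 :: real)"
      using ln2_ge_two_thirds by (intro mult_left_mono) auto
    moreover have "ln 2 \<le> L" using n by (simp add: L_def)
    ultimately show ?thesis by linarith
  qed
  have key: "shifted_key n a (len fst u v) \<le> shifted_key n a (len fst w z)"
    if "less_in r {u, v} {w, z}" for u v w z
    using r[OF that] by (simp add: edge_len_pair a_def L_def)
  have small: ?thesis if "2 ^ height t \<le> 10000 * B"
    using that size by (simp add: B_def L_def)
  have drawn: "drawn fst t" using drawn_if_noncrossing tt by blast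
  have diam: "len fst u v \<le> n" "u \<noteq> v \<Longrightarrow> 1 \<le> len fst u v" if "u \<in> ?V" "v \<in> ?V" for u v
    using len_parabola_points[OF that] by auto
  show ?thesis
  \<comment> \<open>For smaller heights the child subtree has height below 6, too little for
    \<open>lengthening_height\<close> even with \<open>h = 0\<close>; the size is then at most a
    constant.\<close>
  proof (cases "7 \<le> height t")
    case False
    then have "(2::real) ^ height t \<le> 2 ^ 6" by (intro power_increasing) auto
    then show ?thesis using B1 by (intro small) simp
  next
    case True
    then have h2: "2 \<le> height t" by simp
    from tt(6) show ?thesis
      unfolding monotone_tree_def
    proof
      assume "\<forall>p\<in>root_leaf_paths t. decreasing_path r p"
      then have paths: "\<forall>q\<in>root_leaf_paths t. \<forall>i. i + 2 < length q \<longrightarrow>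
          (\<lambda>u v w. less_in r {u, v} {v, w}) (q ! i) (q ! (i + 1)) (q ! (i + 2))"
        by (simp add: decreasing_path_def)
      obtain p s where s: "complete s" "height t = Suc (height s)" "planted fst p s"
        "descending (\<lambda>u v w. less_in r {u, v} {v, w}) p s" "insert p (set_tree s) \<subseteq> set_tree t"
        by (rule root_child_descending[OF tt(1) h2 drawn paths])
      have V: "insert p (set_tree s) \<subseteq> ?V" using s(5) tt(3) by blast
      have "descending (staying_long fst a) p s"
        using s(4)
      proof (rule descending_mono)
        fix u v w assume "u \<in> insert p (set_tree s)" "v \<in> set_tree s" "w \<in> set_tree s"
          and "less_in r {u, v} {v, w}"
        then have "u \<in> ?V" "v \<in> ?V" and le: "less_in r {u, v} {v, w}" using V by auto
        \<comment> \<open>The strict bound keeps the key of a long edge above \<open>- n\<close>,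
          hence above the key of every short edge.\<close>
        then have "len fst u v < n" by (intro len_parabola_points(1))
        moreover have "0 \<le> len fst v w" by (simp add: len_def)
        ultimately show "staying_long fst a u v w"
          using key[OF le] by (auto simp: staying_long_def shifted_key_def split: if_splits)
      qed
      then have "2 ^ (height s - 2) \<le> real n / a + 2 * (a * height s) + 1"
        using s(2) True
        by (intro staying_long_size[OF s(1) _ s(3) _ a V fst_parabola_points_Ints
              inj_on_fst_parabola_points diam(1)]) auto
      moreover have "a * height s \<le> a * (4 * L)" using H s(2) a by (intro mult_left_mono) auto
      moreover have "a * (4 * L) = 4 * (a * L)" by simp
      ultimately have "2 ^ (height s - 2) \<le> 10 * B" unfolding aL using B1 by linarith
      moreover have "height t = 3 + (height s - 2)" using True s(2) by linarith
      then have "(2::real) ^ height t = 8 * 2 ^ (height s - 2)" by (simp only: power_add) simp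
      ultimately show ?thesis using B1 by (intro small) linarith
    next
      assume "\<forall>p\<in>root_leaf_paths t. increasing_path r p"
      then have paths: "\<forall>q\<in>root_leaf_paths t. \<forall>i. i + 2 < length q \<longrightarrow>
          (\<lambda>u v w. less_in r {v, w} {u, v}) (q ! i) (q ! (i + 1)) (q ! (i + 2))"
        by (simp add: increasing_path_def)
      obtain p s where s: "complete s" "height t = Suc (height s)" "planted fst p s"
        "descending (\<lambda>u v w. less_in r {v, w} {u, v}) p s" "insert p (set_tree s) \<subseteq> set_tree t"
        by (rule root_child_descending[OF tt(1) h2 drawn paths])
      have V: "insert p (set_tree s) \<subseteq> ?V" using s(5) tt(3) by blast
      have desc: "descending (lengthening fst a) p s"
        using s(4)
      proof (rule descending_mono)
        fix u v w assume "u \<in> insert p (set_tree s)" "v \<in> set_tree s" "w \<in> set_tree s"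
          and "less_in r {v, w} {u, v}"
        then have "v \<in> ?V" "w \<in> ?V" and le: "less_in r {v, w} {u, v}" using V by auto
        then have "len fst v w < n" by (intro len_parabola_points(1))
        moreover have "0 \<le> len fst u v" by (simp add: len_def)
        ultimately show "lengthening fst a u v w"
          using key[OF le] by (auto simp: lengthening_def shifted_key_def split: if_splits)
      qed
      \<comment> \<open>The largest \<open>h\<close> with \<open>2 * h + 6 <= height s\<close>;
        rounding down costs at most one level, whence the 8 below.\<close>
      define h where "h = (height t - 7) div 2"
      have h: "2 * h + 6 \<le> height s" "height t \<le> 2 * h + 8"
        using True s(2) unfolding h_def by linarith+
      have "2 ^ (2 ^ h) \<le> real n"
        by (rule lengthening_height[OF s(1) h(1) s(3) desc V diam(2,1)])
      then have "ln (2 ^ (2 ^ h)) \<le> L" unfolding L_def by (subst ln_le_cancel_iff) (use n in auto)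
      then have "2 ^ h * ln 2 \<le> L" by (simp add: ln_realpow)
      moreover have "2 ^ h * (1 / 2) \<le> 2 ^ h * ln (2 :: real)"
        using ln2_ge_two_thirds by (intro mult_left_mono) auto
      ultimately have hL: "2 ^ h \<le> 2 * L" by linarith
      have "(2::real) ^ height t \<le> 2 ^ (2 * h + 8)" using h(2) by (intro power_increasing) auto
      also have "\<dots> = 256 * (2 ^ h)\<^sup>2" by (simp only: power_add power_even_eq) simp
      also have "\<dots> \<le> 256 * (2 * L)\<^sup>2" using hL by (intro mult_left_mono power_mono) auto
      finally have "(2::real) ^ height t \<le> 1024 * L\<^sup>2" by (simp add: power_mult_distrib)
      \<comment> \<open>The cube bound gives \<open>L ^ 4 <= 27 * n * L\<close>, which is below
        \<open>(6 * B) ^ 2 = 36 * n * L\<close>. Together with the factor 1024 this yields 6144,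
        within the constant 10000.\<close>
      moreover have "L\<^sup>2 \<le> 6 * B"
      proof (rule power2_le_imp_le)
        have "L ^ 3 * L \<le> 27 * real n * L"
          using ln_cube_le[of "real n"] n L unfolding L_def by (intro mult_right_mono) auto
        also have "\<dots> \<le> 36 * (real n * L)" using L by simp
        also have "\<dots> = (6 * B)\<^sup>2" using L by (simp add: B_def power_mult_distrib)
        finally show "(L\<^sup>2)\<^sup>2 \<le> (6 * B)\<^sup>2" by (simp add: eval_nat_numeral algebra_simps)
      qed (use B1 in simp)
      ultimately show ?thesis using B1 by (intro small) linarith
    qed
  qed
qed

section \<open>From tree sizes to \<open>tau_bar\<close>\<close>

lemma finite_tree_sizes:
  assumes "finite (verts H)"
  shows "finite (size ` noncrossing_monotone_trees H r)"
proof (rule finite_subset)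
  show "size ` noncrossing_monotone_trees H r \<subseteq> {..card (verts H)}"
  proof (rule image_subsetI)
    fix t assume "t \<in> noncrossing_monotone_trees H r"
    then have t: "distinct (inorder t)" "set_tree t \<subseteq> verts H"
      by (auto simp: noncrossing_monotone_trees_def complete_binary_tree_in_def)
    have "size t = card (set_tree t)" using distinct_card[OF t(1)] by simp
    then show "size t \<in> {..card (verts H)}" using card_mono[OF assms t(2)] by simp
  qed
qed simp

text \<open>Shows that the set under \<open>Max\<close> in \<open>tau_geom\<close> is nonempty, so
  that the maximum is attained by a tree.\<close>

lemma singleton_tree_noncrossing_monotone:
  "v \<in> verts H \<Longrightarrow> Node Leaf v Leaf \<in> noncrossing_monotone_trees H r"
  by (simp add: noncrossing_monotone_trees_def complete_binary_tree_in_def monotone_tree_def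
      increasing_path_def noncrossing_tree_def)

theorem theorem6:
  "(\<lambda>n. real (tau_bar (complete_ugraph n))) \<in> O(\<lambda>n. sqrt (real n * ln (real n))) \<and>
   (\<exists>C::real. \<forall>n\<ge>2. \<exists>H\<in>drawings (complete_ugraph n). \<exists>r\<in>edge_orderings H.
      \<forall>t\<in>noncrossing_monotone_trees H r. real (size t) \<le> C * sqrt (real n * ln (real n)))"
proof -
  have main: "\<exists>r\<in>edge_orderings (parabola_drawing n).
      \<forall>t\<in>noncrossing_monotone_trees (parabola_drawing n) r.
        real (size t) \<le> 10000 * sqrt (real n * ln (real n))" if "2 \<le> n" for n
  proof -
    have fin: "finite (edges (parabola_drawing n))"
      by (simp add: parabola_drawing_def finite_imp_finite_nsets card_parabola_points)
    obtain r where r: "linear_order_on (edges (parabola_drawing n)) r"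
      and key: "\<And>e f. less_in r e f \<Longrightarrow> shifted_key n (sqrt (n / ln n)) (edge_len e)
        \<le> shifted_key n (sqrt (n / ln n)) (edge_len f)"
      using linear_order_refining[OF fin, of "\<lambda>e. shifted_key n (sqrt (n / ln n)) (edge_len e)"]
      by blast
    show ?thesis
      using r parabola_tree_size[OF that key] by (intro bexI[of _ r]) (auto simp: edge_orderings_def)
  qed
  have tau: "real (tau_bar (complete_ugraph n)) \<le> 10000 * sqrt (real n * ln (real n))"
    if n: "2 \<le> n" for n
  proof -
    let ?H = "parabola_drawing n"
    obtain r where r: "r \<in> edge_orderings ?H" "\<And>t. t \<in> noncrossing_monotone_trees ?H r \<Longrightarrow>
        real (size t) \<le> 10000 * sqrt (real n * ln (real n))"
      using main[OF n] by blast
    have "tau_bar (complete_ugraph n) \<le> tau_geom ?H"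
      unfolding tau_bar_def by (rule cINF_lower[OF _ parabola_drawing_in_drawings]) simp
    also have "\<dots> \<le> Max (size ` noncrossing_monotone_trees ?H r)"
      unfolding tau_geom_def by (rule cINF_lower[OF _ r(1)]) simp
    finally have "tau_bar (complete_ugraph n) \<le> Max (size ` noncrossing_monotone_trees ?H r)" .
    moreover have "Max (size ` noncrossing_monotone_trees ?H r) \<in> size ` noncrossing_monotone_trees ?H r"
    proof (rule Max_in)
      show "finite (size ` noncrossing_monotone_trees ?H r)"
        by (rule finite_tree_sizes) (simp add: parabola_drawing_def card_parabola_points)
      have "parabola 0 \<in> verts ?H"
        using n by (auto simp: parabola_drawing_def parabola_points_def intro: image_eqI[of _ _ 0])
      then show "size ` noncrossing_monotone_trees ?H r \<noteq> {}"
        using singleton_tree_noncrossing_monotone by blast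
    qed
    ultimately obtain t where "t \<in> noncrossing_monotone_trees ?H r"
      "tau_bar (complete_ugraph n) \<le> size t" by auto
    then show ?thesis using r(2)[of t] by linarith
  qed
  have "(\<lambda>n. real (tau_bar (complete_ugraph n))) \<in> O(\<lambda>n. sqrt (real n * ln (real n)))"
    using tau by (intro bigoI[where c = 10000] eventually_sequentiallyI[of 2]) simp
  moreover have "\<exists>C::real. \<forall>n\<ge>2. \<exists>H\<in>drawings (complete_ugraph n). \<exists>r\<in>edge_orderings H.
      \<forall>t\<in>noncrossing_monotone_trees H r. real (size t) \<le> C * sqrt (real n * ln (real n))"
    using main parabola_drawing_in_drawings by blast
  ultimately show ?thesis ..
qed

end
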